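(* Let $\mathbb F\in\{\mathbb R,\mathbb C\}$ and let $\mathcal X$ be a two-dimensional BJ-normed space over $\mathbb F$. Then the following conditions are equivalent for $x\in\Gamma_0(\mathcal X)$: (i) $x$ corresponds to a smooth point in $\mathcal X$. (ii) The vertex $x\in\Gamma_0(\mathcal X)$ has no loop and every two nonzero elements of $x^\perp$ are BJ-equivalent.
   Context: For $u,v\in\mathcal X$, $u\perp v$ (Birkhoff--James orthogonality) means $\|u+\lambda v\|\ge\|u\|$ for all $\lambda\in\mathbb F$. $\Gamma_0(\mathcal X)$ is the directed graph whose vertices are all vectors of $\mathcal X$, with an edge $u\rightarrow v$ if and only if $u\perp v$; $0$ is the only vertex with a loop. For a vertex $u$, $u^\perp=\{v : u\rightarrow v\}$ and ${}^\perp u=\{v : v\rightarrow u\}$. Elements $u,v$ are BJ-equivalent if $u^\perp=v^\perp$ and ${}^\perp u={}^\perp v$. A norm is a BJ-norm (and the space is BJ-normed) if BJ-equivalent elements are always linearly dependent. A nonzero vector $u$ is smooth if it has a unique supporting functional ($f\in\mathcal X^*$ with $\|f\|=1$, $f(u)=\|u\|$). *)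

theory Defs
  imports "HOL-Analysis.Operator_Norm" "Graph_Theory.Pair_Digraph"
begin

text \<open>
  The libraries have no class of complex normed spaces.  A normed space over a scalar field
  such as \<open>\<real>\<close> or \<open>\<complex>\<close> is a type of class \<open>real_normed_vector\<close> (addition, norm, topology) together
  with a scalar multiplication that extends \<open>(*\<^sub>R)\<close> and for which the norm is homogeneous.
\<close>

locale normed_space_over = vector_space scale
  for scale :: "'f::real_normed_field \<Rightarrow> 'v::real_normed_vector \<Rightarrow> 'v" +
  assumes scale_of_real: "scale (of_real r) v = r *\<^sub>R v"
    and norm_scale: "norm (scale c v) = norm c * norm v"

lemma normed_space_over_scaleR:
  "normed_space_over ((*\<^sub>R) :: real \<Rightarrow> 'v::real_normed_vector \<Rightarrow> 'v)"
  by unfold_locales (simp_all add: algebra_simps)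

lemma normed_space_over_real_unique:
  assumes "normed_space_over (scale :: real \<Rightarrow> 'v::real_normed_vector \<Rightarrow> 'v)"
  shows "scale = (*\<^sub>R)"
  using normed_space_over.scale_of_real[OF assms] by (auto simp: fun_eq_iff)

definition BJ_orthogonal ::
    "('f::real_normed_field \<Rightarrow> 'v::real_normed_vector \<Rightarrow> 'v) \<Rightarrow> 'v \<Rightarrow> 'v \<Rightarrow> bool" where
  "BJ_orthogonal scale u v \<longleftrightarrow> (\<forall>c. norm (u + scale c v) \<ge> norm u)"

definition BJ_digraph ::
    "('f::real_normed_field \<Rightarrow> 'v::real_normed_vector \<Rightarrow> 'v) \<Rightarrow> 'v pair_pre_digraph"
    ("\<Gamma>\<^sub>0") where
  "\<Gamma>\<^sub>0 scale = \<lparr> pverts = UNIV, parcs = {(u, v). BJ_orthogonal scale u v} \<rparr>"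

definition out_nbhd :: "'v pair_pre_digraph \<Rightarrow> 'v \<Rightarrow> 'v set" where
  "out_nbhd G u = {v \<in> pverts G. (u, v) \<in> parcs G}"

definition in_nbhd :: "'v pair_pre_digraph \<Rightarrow> 'v \<Rightarrow> 'v set" where
  "in_nbhd G u = {v \<in> pverts G. (v, u) \<in> parcs G}"

definition has_loop :: "'v pair_pre_digraph \<Rightarrow> 'v \<Rightarrow> bool" where
  "has_loop G u \<longleftrightarrow> (u, u) \<in> parcs G"

definition BJ_equivalent ::
    "('f::real_normed_field \<Rightarrow> 'v::real_normed_vector \<Rightarrow> 'v) \<Rightarrow> 'v \<Rightarrow> 'v \<Rightarrow> bool" where
  "BJ_equivalent scale u v \<longleftrightarrow>
     out_nbhd (\<Gamma>\<^sub>0 scale) u = out_nbhd (\<Gamma>\<^sub>0 scale) v \<and>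
     in_nbhd (\<Gamma>\<^sub>0 scale) u = in_nbhd (\<Gamma>\<^sub>0 scale) v"

text \<open>
  Linear dependence of the pair \<open>(u, v)\<close> as a family: \<open>(u, u)\<close> is dependent, although the set
  \<open>{u, u}\<close> is independent for \<open>u \<noteq> 0\<close>.
\<close>

definition dependent_pair ::
    "('f::real_normed_field \<Rightarrow> 'v::real_normed_vector \<Rightarrow> 'v) \<Rightarrow> 'v \<Rightarrow> 'v \<Rightarrow> bool" where
  "dependent_pair scale u v \<longleftrightarrow> (\<exists>a b. (a \<noteq> 0 \<or> b \<noteq> 0) \<and> scale a u + scale b v = 0)"

definition BJ_normed ::
    "('f::real_normed_field \<Rightarrow> 'v::real_normed_vector \<Rightarrow> 'v) \<Rightarrow> bool" where
  "BJ_normed scale \<longleftrightarrow> (\<forall>u v. BJ_equivalent scale u v \<longrightarrow> dependent_pair scale u v)"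

definition dual_space ::
    "('f::real_normed_field \<Rightarrow> 'v::real_normed_vector \<Rightarrow> 'v) \<Rightarrow> ('v \<Rightarrow> 'f) set" where
  "dual_space scale = {f. Vector_Spaces.linear scale (*) f \<and> bounded_linear f}"

definition supporting_functional ::
    "('f::real_normed_field \<Rightarrow> 'v::real_normed_vector \<Rightarrow> 'v) \<Rightarrow> 'v \<Rightarrow> ('v \<Rightarrow> 'f) \<Rightarrow> bool" where
  "supporting_functional scale u f \<longleftrightarrow>
     f \<in> dual_space scale \<and> onorm f = 1 \<and> f u = of_real (norm u)"

definition smooth_point ::
    "('f::real_normed_field \<Rightarrow> 'v::real_normed_vector \<Rightarrow> 'v) \<Rightarrow> 'v \<Rightarrow> bool" where
  "smooth_point scale u \<longleftrightarrow> u \<noteq> 0 \<and> (\<exists>!f. supporting_functional scale u f)"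

end

theory Submission
  imports Defs "HOL-Analysis.Product_Vector"
begin

text \<open>
  If \<open>x \<perp> v\<close> with \<open>v \<noteq> 0\<close> in a plane, then \<open>x, v\<close> form a basis and \<open>a x + b v \<mapsto> a \<parallel>x\<parallel>\<close> supports \<open>x\<close>;
  conversely \<open>x\<close> is orthogonal to the kernel of each of its supporting functionals.  Hence
  supporting functionals at \<open>x\<close> correspond to the lines in \<open>x\<^sup>\<perp>\<close>, of which there is at least one by
  Hahn--Banach, and smoothness says that \<open>x\<^sup>\<perp>\<close> is a single line.  Proportional nonzero vectors are
  always BJ-equivalent, and the BJ-norm hypothesis is the converse.
\<close>

section \<open>Loops, neighbourhoods and scaling of orthogonality\<close>

context normed_space_over
begin

lemma has_loop_iff: "has_loop (\<Gamma>\<^sub>0 scale) x \<longleftrightarrow> x = 0"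
proof -
  have "x = 0" if "\<forall>c. norm x \<le> norm (x + scale c x)"
    using that[rule_format, of "-1"] by simp
  then show ?thesis
    by (auto simp: has_loop_def BJ_digraph_def BJ_orthogonal_def)
qed

lemma out_nbhd_BJ_digraph: "out_nbhd (\<Gamma>\<^sub>0 scale) u = {v. BJ_orthogonal scale u v}"
  by (simp add: out_nbhd_def BJ_digraph_def)

lemma in_nbhd_BJ_digraph: "in_nbhd (\<Gamma>\<^sub>0 scale) u = {v. BJ_orthogonal scale v u}"
  by (simp add: in_nbhd_def BJ_digraph_def)

lemma BJ_orthogonal_scale_left:
  assumes "k \<noteq> 0"
  shows "BJ_orthogonal scale (scale k u) v \<longleftrightarrow> BJ_orthogonal scale u v"
proof -
  \<comment> \<open>Division by \<open>k\<close> permutes the scalars, so \<open>c / k\<close> still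
    runs through all of them.\<close>
  have n: "norm (scale k u + scale c v) = norm k * norm (u + scale (c / k) v)" for c
    using assms by (simp add: norm_scale[symmetric] scale_right_distrib)
  have "BJ_orthogonal scale (scale k u) v \<longleftrightarrow> (\<forall>c. norm u \<le> norm (u + scale (c / k) v))"
    using assms by (simp add: BJ_orthogonal_def n norm_scale)
  also have "\<dots> \<longleftrightarrow> BJ_orthogonal scale u v"
    unfolding BJ_orthogonal_def using assms by (metis nonzero_mult_div_cancel_right)
  finally show ?thesis .
qed

lemma BJ_orthogonal_scale_right:
  assumes "k \<noteq> 0"
  shows "BJ_orthogonal scale u (scale k v) \<longleftrightarrow> BJ_orthogonal scale u v"
  unfolding BJ_orthogonal_def scale_scale
  using assms by (metis nonzero_eq_divide_eq)

lemma BJ_equivalent_scale: "k \<noteq> 0 \<Longrightarrow> BJ_equivalent scale u (scale k u)"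
  by (simp add: BJ_equivalent_def out_nbhd_BJ_digraph in_nbhd_BJ_digraph
      BJ_orthogonal_scale_left BJ_orthogonal_scale_right)

lemma dependent_pair_scaleE:
  assumes "dependent_pair scale u v" "u \<noteq> 0" "v \<noteq> 0"
  obtains k where "k \<noteq> 0" "v = scale k u"
proof -
  obtain a b where ab: "a \<noteq> 0 \<or> b \<noteq> 0" "scale a u + scale b v = 0"
    using assms(1) by (auto simp: dependent_pair_def)
  then have nz: "a \<noteq> 0" "b \<noteq> 0"
    using assms by auto
  have "scale b v = scale (- a) u"
    using ab(2) by (simp add: eq_neg_iff_add_eq_0 add.commute)
  then have "scale (1 / b) (scale b v) = scale (1 / b) (scale (- a) u)"
    by simp
  then have "v = scale (- a / b) u"
    using nz by simp
  with nz show thesis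
    by (intro that[of "- a / b"]) auto
qed

text \<open>Otherwise subtracting a multiple of \<open>v\<close> from \<open>x\<close> would give 0,
  which is shorter than \<open>x\<close>.\<close>

lemma BJ_orthogonal_not_in_span:
  assumes "BJ_orthogonal scale x v" "x \<noteq> 0"
  shows "x \<notin> span {v}"
proof
  assume "x \<in> span {v}"
  then obtain k where "x = scale k v"
    by (auto simp: span_singleton)
  then have "norm (x + scale (- k) v) = 0"
    by simp
  with assms show False
    unfolding BJ_orthogonal_def by (metis norm_le_zero_iff)
qed

text \<open>For nonzero \<open>a\<close>, \<open>scale a x\<close> is orthogonal to \<open>v\<close>
  as well. This is the bound that gives \<open>a x + b v \<mapsto> a * norm x\<close> norm at most
  one.\<close>

lemma BJ_orthogonal_norm_le:
  assumes "BJ_orthogonal scale x v"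
  shows "norm a * norm x \<le> norm (scale a x + scale b v)"
proof (cases "a = 0")
  case False
  then have "BJ_orthogonal scale (scale a x) v"
    using assms by (simp add: BJ_orthogonal_scale_left)
  then show ?thesis
    by (simp add: BJ_orthogonal_def norm_scale)
qed simp

section \<open>Supporting functionals by explicit conditions\<close>

lemma dual_space_iff:
  "f \<in> dual_space scale \<longleftrightarrow>
     (\<forall>u v. f (u + v) = f u + f v) \<and> (\<forall>c u. f (scale c u) = c * f u) \<and>
     (\<exists>K. \<forall>u. norm (f u) \<le> norm u * K)"
proof -
  have "vector_space ((*) :: 'f \<Rightarrow> 'f \<Rightarrow> 'f)"
    by unfold_locales (simp_all add: algebra_simps)
  then have "Vector_Spaces.linear scale (*) f \<longleftrightarrow>
      (\<forall>u v. f (u + v) = f u + f v) \<and> (\<forall>c u. f (scale c u) = c * f u)"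
    by (simp add: Vector_Spaces.linear_iff vector_space_axioms)
  \<comment> \<open>As \<open>scale\<close> extends real scalar multiplication, linearity over the
    scalar field contains the real linearity inside \<open>bounded_linear\<close>.\<close>
  moreover have "linear f" if "\<forall>u v. f (u + v) = f u + f v" "\<forall>c u. f (scale c u) = c * f u"
    using that by (intro linearI) (simp_all add: scale_of_real[symmetric] scaleR_conv_of_real)
  ultimately show ?thesis
    unfolding dual_space_def bounded_linear_def bounded_linear_axioms_def by blast
qed

text \<open>Norm one reduces to norm at most one: the value \<open>norm x\<close> at the nonzero
  \<open>x\<close> forces \<open>onorm f\<close> to be at least 1.\<close>

lemma supporting_functional_iff:
  assumes "x \<noteq> 0"
  shows "supporting_functional scale x f \<longleftrightarrow>
     (\<forall>u v. f (u + v) = f u + f v) \<and> (\<forall>c u. f (scale c u) = c * f u) \<and>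
     (\<forall>u. norm (f u) \<le> norm u) \<and> f x = of_real (norm x)"
    (is "_ \<longleftrightarrow> ?R")
proof
  assume f: "supporting_functional scale x f"
  then have "f \<in> dual_space scale"
    by (simp add: supporting_functional_def)
  moreover from this have "norm (f u) \<le> norm u" for u
    using f onorm[of f u] by (simp add: supporting_functional_def dual_space_def)
  ultimately show ?R
    using f by (simp add: supporting_functional_def dual_space_iff)
next
  assume f: ?R
  then have dual: "f \<in> dual_space scale"
    unfolding dual_space_iff by (metis mult.right_neutral)
  have "onorm f \<le> 1"
    using f by (intro onorm_bound) auto
  moreover have "norm (f x) \<le> onorm f * norm x"
    using dual by (intro onorm) (simp add: dual_space_def)
  then have "1 \<le> onorm f"
    using f assms by simp
  ultimately show "supporting_functional scale x f"
    using f dual by (simp add: supporting_functional_def)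
qed

text \<open>\<open>f\<close> has the constant value \<open>norm x\<close> on all
  \<open>x + scale c u\<close>, and its modulus never exceeds the norm.\<close>

lemma BJ_orthogonal_supporting_kernel:
  assumes "x \<noteq> 0" "supporting_functional scale x f" "f u = 0"
  shows "BJ_orthogonal scale x u"
  unfolding BJ_orthogonal_def
proof
  fix c
  have "f (x + scale c u) = of_real (norm x)"
    using assms by (simp add: supporting_functional_iff)
  then have "norm x = norm (f (x + scale c u))"
    by simp
  also have "\<dots> \<le> norm (x + scale c u)"
    using assms(2) unfolding supporting_functional_iff[OF assms(1)] by blast
  finally show "norm x \<le> norm (x + scale c u)" .
qed

end

section \<open>Planes: supporting functionals determined by their kernels\<close>

locale normed_plane_over = normed_space_over +
  assumes dim_UNIV: "dim UNIV = 2"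
begin

text \<open>\<open>x\<close> and \<open>v\<close> are independent; a \<open>y\<close> outside their
  span would give three independent vectors, more than a basis of the plane has.\<close>

lemma not_in_span_decompose:
  assumes "x \<notin> span {v}" "v \<noteq> 0"
  obtains a b where "y = scale a x + scale b v"
proof -
  have ind: "independent {x, v}" and card: "card {x, v} = 2"
    using assms span_base[of x "{v}"] by (auto simp: independent_insert card_2_iff)
  obtain B where B: "independent B" "UNIV \<subseteq> span B" "card B = 2"
    using basis_exists[of UNIV] dim_UNIV by metis
  \<comment> \<open>\<open>card\<close> is 0 on infinite sets, so cardinality 2 also yields
    finiteness.\<close>
  then have "finite B"
    by (metis card.infinite zero_neq_numeral)
  have "y \<in> span {x, v}"
  proof (rule ccontr)
    assume y: "y \<notin> span {x, v}"
    then have "independent (insert y {x, v})"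
      using ind by (metis independent_insertI)
    then have "card (insert y {x, v}) \<le> card B"
      using B \<open>finite B\<close> independent_span_bound by blast
    moreover have "y \<notin> {x, v}"
      using y span_base by blast
    then have "card (insert y {x, v}) = 3"
      using card by simp
    ultimately show False
      using B by simp
  qed
  then show thesis
    using that by (auto simp: span_insert span_singleton algebra_simps)
qed

lemma ex_not_in_span_singleton: "\<exists>w. w \<notin> span {x}"
proof (rule ccontr)
  assume "\<not> ?thesis"
  then have "dim UNIV \<le> card {x}"
    by (intro dim_le_card) auto
  then show False
    by (simp add: dim_UNIV)
qed

lemma BJ_orthogonal_supporting_functional:
  assumes x: "x \<noteq> 0" and v: "v \<noteq> 0" and xv: "BJ_orthogonal scale x v"
  shows "\<exists>f. supporting_functional scale x f \<and> f v = 0"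
proof -
  have nin: "x \<notin> span {v}"
    using BJ_orthogonal_not_in_span[OF xv x] .
  then have ind: "independent {x, v}"
    using v by (simp add: independent_insert)
  have "x \<noteq> v"
    using nin span_base by blast
  have span: "y \<in> span {x, v}" for y
    by (rule not_in_span_decompose[OF nin v, of y])
      (simp add: span_add span_scale span_base)
  \<comment> \<open>The coordinate along \<open>x\<close> in the basis \<open>{x, v}\<close>,
    rescaled to take the value \<open>norm x\<close> at \<open>x\<close>.\<close>
  define f where "f y = representation {x, v} y x * of_real (norm x)" for y
  have "f (y + z) = f y + f z" for y z
    using representation_add[OF ind span span] by (simp add: f_def algebra_simps)
  moreover have "f (scale c y) = c * f y" for c y
    using representation_scale[OF ind span] by (simp add: f_def algebra_simps)
  moreover have fx: "f x = of_real (norm x)" and fv: "f v = 0"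
    using ind \<open>x \<noteq> v\<close> by (simp_all add: f_def representation_basis)
  moreover have "norm (f y) \<le> norm y" for y
  proof -
    obtain a b where y: "y = scale a x + scale b v"
      using not_in_span_decompose[OF nin v] .
    then have "f y = a * of_real (norm x)"
      using calculation by simp
    then show ?thesis
      using BJ_orthogonal_norm_le[OF xv, of a b] y by (simp add: norm_mult)
  qed
  ultimately show ?thesis
    using x by (auto simp: supporting_functional_iff)
qed

text \<open>\<open>x\<close> is orthogonal to the kernel vector \<open>v\<close>, hence off its
  line, so the values at \<open>x\<close> and \<open>v\<close> determine the functional.\<close>

lemma supporting_functional_eqI:
  assumes x: "x \<noteq> 0" and v: "v \<noteq> 0"
    and f: "supporting_functional scale x f" "f v = 0"
    and g: "supporting_functional scale x g" "g v = 0"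
  shows "f = g"
proof
  fix y
  have nin: "x \<notin> span {v}"
    using BJ_orthogonal_not_in_span BJ_orthogonal_supporting_kernel x f by blast
  obtain a b where "y = scale a x + scale b v"
    using not_in_span_decompose[OF nin v] .
  then show "f y = g y"
    using f g x by (simp add: supporting_functional_iff)
qed

text \<open>The hypothesis \<open>ex_orth\<close> isolates the Hahn--Banach input, which is proved
  separately for each scalar field: every coset of the line through \<open>x\<close> meets the
  vectors orthogonal to \<open>x\<close>.\<close>

theorem smooth_point_iff_BJ_equivalent:
  assumes BJ: "BJ_normed scale"
    and ex_orth: "\<And>w. x \<noteq> 0 \<Longrightarrow> \<exists>T. BJ_orthogonal scale x (w + scale T x)"
  shows "smooth_point scale x \<longleftrightarrow>
     \<not> has_loop (\<Gamma>\<^sub>0 scale) x \<and>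
     (\<forall>u \<in> out_nbhd (\<Gamma>\<^sub>0 scale) x - {0}. \<forall>v \<in> out_nbhd (\<Gamma>\<^sub>0 scale) x - {0}. BJ_equivalent scale u v)"
proof (cases "x = 0")
  case True
  then show ?thesis
    by (simp add: smooth_point_def has_loop_iff)
next
  case x: False
  have "BJ_equivalent scale u v"
    if smooth: "smooth_point scale x" and u: "u \<noteq> 0" "BJ_orthogonal scale x u"
      and v: "v \<noteq> 0" "BJ_orthogonal scale x v" for u v
  proof -
    \<comment> \<open>By uniqueness the functionals vanishing at \<open>u\<close> and at
      \<open>v\<close> are the same one; evaluating it at \<open>v\<close> kills the coordinate
      along \<open>x\<close>.\<close>
    obtain f where f: "supporting_functional scale x f" "f u = 0" "f v = 0"
      using BJ_orthogonal_supporting_functional[OF x] u v smooth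
      by (metis smooth_point_def)
    obtain a b where ab: "v = scale a x + scale b u"
      using not_in_span_decompose[OF BJ_orthogonal_not_in_span] x u by metis
    then have "a * of_real (norm x) = 0"
      using f x by (simp add: supporting_functional_iff)
    then have "v = scale b u" "b \<noteq> 0"
      using ab x v by auto
    then show ?thesis
      by (simp add: BJ_equivalent_scale)
  qed
  moreover have "smooth_point scale x"
    if equiv: "\<And>u v. \<lbrakk>u \<noteq> 0; BJ_orthogonal scale x u; v \<noteq> 0; BJ_orthogonal scale x v\<rbrakk>
      \<Longrightarrow> BJ_equivalent scale u v"
  proof -
    obtain w where w: "w \<notin> span {x}"
      using ex_not_in_span_singleton by blast
    \<comment> \<open>With \<open>w\<close> off the line through \<open>x\<close>, no shift along
      \<open>x\<close> is zero; this serves both \<open>v\<close> and \<open>u\<close>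
      below.\<close>
    have nz: "w + scale T x \<noteq> 0" for T
      using w by (metis add_eq_0_iff2 span_neg span_scale span_base singletonI)
    obtain T where T: "BJ_orthogonal scale x (w + scale T x)"
      using ex_orth x by blast
    define v where "v = w + scale T x"
    have v: "v \<noteq> 0" "BJ_orthogonal scale x v"
      using nz T by (simp_all add: v_def)
    \<comment> \<open>Once all supporting functionals vanish at the same \<open>v\<close>, any two
      of them agree.\<close>
    have gv: "g v = 0" if g: "supporting_functional scale x g" for g
    proof -
      \<comment> \<open>This multiple of \<open>x\<close> moves \<open>v\<close> into the kernel of
        \<open>g\<close>; the BJ-norm then makes \<open>v\<close> a multiple of \<open>u\<close>, so
        \<open>g v\<close> is 0.\<close>
      define c where "c = g v / of_real (norm x)"
      define u where "u = v + scale (- c) x"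
      have g_add: "g (y + z) = g y + g z" and g_scale: "g (scale k y) = k * g y"
        and gx: "g x = of_real (norm x)" for y z k
        using g x by (simp_all add: supporting_functional_iff)
      have gu: "g u = 0"
        unfolding u_def g_add g_scale gx using x by (simp add: c_def)
      have u0: "u \<noteq> 0"
        using nz[of "T - c"] by (simp add: u_def v_def algebra_simps)
      have "BJ_equivalent scale u v"
        using equiv u0 v BJ_orthogonal_supporting_kernel[OF x g gu] by blast
      then obtain k where "v = scale k u"
        using BJ u0 v dependent_pair_scaleE by (metis BJ_normed_def)
      then show ?thesis
        by (simp add: g_scale gu)
    qed
    then show ?thesis
      unfolding smooth_point_def
      using x BJ_orthogonal_supporting_functional[OF x v] supporting_functional_eqI[OF x v(1)]
      by blast
  qed
  ultimately show ?thesis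
    using x by (auto simp: has_loop_iff out_nbhd_BJ_digraph)
qed

end

section \<open>Hahn--Banach extension and orthogonal vectors in cosets\<close>

text \<open>
  The one-dimensional extension step of Hahn--Banach.  Parametrizing the subspace by a linear map
  \<open>L\<close> makes the step iterable without checking that the extended functional is well defined.
\<close>

lemma Hahn_Banach_step:
  fixes L :: "'u::real_vector \<Rightarrow> 'v::real_normed_vector" and g :: "'u \<Rightarrow> real"
  assumes L: "linear L" and g: "linear g" and le: "\<And>u. g u \<le> norm (L u)"
  shows "\<exists>t. \<forall>u r. g u + r * t \<le> norm (L u + r *\<^sub>R w)"
proof -
  \<comment> \<open>The cases \<open>r = -1\<close> and \<open>r = 1\<close> bound \<open>t\<close>
    from below and above; each lower bound lies under each upper bound.\<close>
  have sep: "g u - norm (L u - w) \<le> norm (L u' + w) - g u'" for u u'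
  proof -
    have "g u + g u' = g (u + u')"
      using g by (simp add: linear_add)
    also have "\<dots> \<le> norm (L (u + u'))"
      by (rule le)
    also have "L (u + u') = (L u - w) + (L u' + w)"
      using L by (simp add: linear_add)
    also have "norm \<dots> \<le> norm (L u - w) + norm (L u' + w)"
      by (rule norm_triangle_ineq)
    finally show ?thesis
      by simp
  qed
  define t where "t = (SUP u. g u - norm (L u - w))"
  have bdd: "bdd_above (range (\<lambda>u. g u - norm (L u - w)))"
    using sep by (intro bdd_aboveI2[where M = "norm (L 0 + w) - g 0"])
  have lower: "g u - norm (L u - w) \<le> t" for u
    unfolding t_def by (intro cSUP_upper bdd) simp
  have upper: "t \<le> norm (L u + w) - g u" for u
    unfolding t_def by (intro cSUP_least sep) simp
  \<comment> \<open>Homogeneity: dividing by the modulus of a nonzero \<open>r\<close> reduces to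
    \<open>r = 1\<close> or \<open>r = -1\<close>.\<close>
  have "g u + r * t \<le> norm (L u + r *\<^sub>R w)" for u r
  proof (cases r "0 :: real" rule: linorder_cases)
    case equal
    then show ?thesis
      by (simp add: le)
  next
    case greater
    have "g u + r * t = r * (g (u /\<^sub>R r) + t)"
      using greater g by (simp add: linear_cmul field_simps)
    also have "\<dots> \<le> r * norm (L (u /\<^sub>R r) + w)"
      using greater upper[of "u /\<^sub>R r"] by (intro mult_left_mono) auto
    also have "\<dots> = norm (r *\<^sub>R (L (u /\<^sub>R r) + w))"
      using greater by simp
    also have "r *\<^sub>R (L (u /\<^sub>R r) + w) = L u + r *\<^sub>R w"
      using greater L by (simp add: linear_cmul scaleR_right_distrib)
    finally show ?thesis .
  next
    case less
    define s where "s = - r"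
    have s: "0 < s" "r = - s"
      using less by (simp_all add: s_def)
    have "g u + r * t = s * (g (u /\<^sub>R s) - t)"
      using s g by (simp add: linear_cmul field_simps)
    also have "\<dots> \<le> s * norm (L (u /\<^sub>R s) - w)"
      using s lower[of "u /\<^sub>R s"] by (intro mult_left_mono) auto
    also have "\<dots> = norm (s *\<^sub>R (L (u /\<^sub>R s) - w))"
      using s by simp
    also have "s *\<^sub>R (L (u /\<^sub>R s) - w) = L u + r *\<^sub>R w"
      using s L by (simp add: linear_cmul scaleR_right_diff_distrib)
    finally show ?thesis .
  qed
  then show ?thesis
    by blast
qed

text \<open>Extend \<open>u x \<mapsto> u * norm x\<close> from the line through \<open>x\<close> to
  \<open>w\<close>, with value \<open>t\<close> there; \<open>T\<close> puts \<open>w + T x\<close>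
  in the kernel.\<close>

lemma ex_BJ_orthogonal_real:
  fixes x w :: "'v::real_normed_vector"
  assumes "x \<noteq> 0"
  shows "\<exists>T. BJ_orthogonal (*\<^sub>R) x (w + T *\<^sub>R x)"
proof -
  have "\<exists>t. \<forall>u r. u * norm x + r * t \<le> norm (u *\<^sub>R x + r *\<^sub>R w)"
    by (intro Hahn_Banach_step linearI) (simp_all add: algebra_simps mult_right_mono)
  then obtain t where t: "u * norm x + r * t \<le> norm (u *\<^sub>R x + r *\<^sub>R w)" for u r
    by blast
  define T where "T = - t / norm x"
  have "norm x \<le> norm (x + c *\<^sub>R (w + T *\<^sub>R x))" for c
    using t[of "1 + c * T" c] assms by (simp add: T_def algebra_simps)
  then show ?thesis
    unfolding BJ_orthogonal_def by blast
qed

text \<open>The real functional \<open>Re \<alpha> * norm x\<close> on the complex line through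
  \<open>x\<close> is extended twice, to \<open>w\<close> and to \<open>\<i> w\<close>, and then
  read as the real part of a complex one.\<close>

lemma ex_BJ_orthogonal_complex:
  fixes scale :: "complex \<Rightarrow> 'v::real_normed_vector \<Rightarrow> 'v"
  assumes "normed_space_over scale" and x: "x \<noteq> 0"
  shows "\<exists>T. BJ_orthogonal scale x (w + scale T x)"
proof -
  interpret normed_space_over scale by fact
  have scaleR: "scale (r *\<^sub>R c) v = r *\<^sub>R scale c v" for r c v
    by (metis scale_of_real scale_scale scaleR_conv_of_real)
  have "\<exists>t. \<forall>\<alpha> r. Re \<alpha> * norm x + r * t \<le> norm (scale \<alpha> x + r *\<^sub>R w)"
    by (intro Hahn_Banach_step linearI)
      (simp_all add: distrib_right scale_left_distrib scaleR norm_scale mult_right_mono complex_Re_le_cmod)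
  then obtain t1 where t1: "Re \<alpha> * norm x + r * t1 \<le> norm (scale \<alpha> x + r *\<^sub>R w)" for \<alpha> r
    by blast
  have "\<exists>t. \<forall>p s. (Re (fst p) * norm x + snd p * t1) + s * t
      \<le> norm ((scale (fst p) x + snd p *\<^sub>R w) + s *\<^sub>R scale \<i> w)"
    by (rule Hahn_Banach_step[where L = "\<lambda>p. scale (fst p) x + snd p *\<^sub>R w"
          and g = "\<lambda>p. Re (fst p) * norm x + snd p * t1"])
      (auto intro!: linearI simp: t1 scale_left_distrib scaleR_left_distrib scaleR
        scaleR_right_distrib distrib_right distrib_left)
  then obtain t2 where t2: "(Re \<alpha> * norm x + r * t1) + s * t2
      \<le> norm ((scale \<alpha> x + r *\<^sub>R w) + s *\<^sub>R scale \<i> w)" for \<alpha> r s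
    by (metis fst_conv snd_conv)
  \<comment> \<open>The sign makes
    \<open>Re (\<beta> * t) = Re \<beta> * t1 + Im \<beta> * t2\<close>, so \<open>t\<close> is the
    complex value at \<open>w\<close>.\<close>
  define t where "t = Complex t1 (- t2)"
  have Re_le: "Re (\<alpha> * of_real (norm x) + \<beta> * t) \<le> norm (scale \<alpha> x + scale \<beta> w)" for \<alpha> \<beta>
  proof -
    have "\<beta> = of_real (Re \<beta>) + Im \<beta> *\<^sub>R \<i>"
      by (simp add: complex_eq_iff)
    then have "scale \<beta> w = Re \<beta> *\<^sub>R w + Im \<beta> *\<^sub>R scale \<i> w"
      by (metis scale_left_distrib scale_of_real scaleR)
    then show ?thesis
      using t2[of \<alpha> "Re \<beta>" "Im \<beta>"] by (simp add: t_def add.assoc)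
  qed
  define T where "T = - t / of_real (norm x)"
  have "norm x \<le> norm (x + scale c (w + scale T x))" for c
  proof -
    have "x + scale c (w + scale T x) = scale (1 + c * T) x + scale c w"
      by (simp add: algebra_simps)
    \<comment> \<open>The value is real, so the bound \<open>Re_le\<close> on real parts
      suffices.\<close>
    moreover have "(1 + c * T) * of_real (norm x) + c * t = of_real (norm x)"
      using x by (simp add: T_def field_simps)
    ultimately show ?thesis
      using Re_le[of "1 + c * T" c] by simp
  qed
  then show ?thesis
    unfolding BJ_orthogonal_def by blast
qed

section \<open>The real and the complex case\<close>

theorem corollary3p5:
  fixes x :: "'a::real_normed_vector"
    and scaleC :: "complex \<Rightarrow> 'b::real_normed_vector \<Rightarrow> 'b" and z :: 'b
  shows
   "(vector_space.dim ((*\<^sub>R) :: real \<Rightarrow> 'a \<Rightarrow> 'a) UNIV = 2 \<and>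
     BJ_normed ((*\<^sub>R) :: real \<Rightarrow> 'a \<Rightarrow> 'a) \<longrightarrow>
       (smooth_point (*\<^sub>R) x \<longleftrightarrow>
         \<not> has_loop (\<Gamma>\<^sub>0 (*\<^sub>R)) x \<and>
         (\<forall>u \<in> out_nbhd (\<Gamma>\<^sub>0 (*\<^sub>R)) x - {0}. \<forall>v \<in> out_nbhd (\<Gamma>\<^sub>0 (*\<^sub>R)) x - {0}.
            BJ_equivalent (*\<^sub>R) u v)))
    \<and>
    (normed_space_over scaleC \<and> vector_space.dim scaleC UNIV = 2 \<and> BJ_normed scaleC \<longrightarrow>
       (smooth_point scaleC z \<longleftrightarrow>
         \<not> has_loop (\<Gamma>\<^sub>0 scaleC) z \<and>
         (\<forall>u \<in> out_nbhd (\<Gamma>\<^sub>0 scaleC) z - {0}. \<forall>v \<in> out_nbhd (\<Gamma>\<^sub>0 scaleC) z - {0}.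
            BJ_equivalent scaleC u v)))"
proof (intro conjI impI; elim conjE)
  assume "vector_space.dim ((*\<^sub>R) :: real \<Rightarrow> 'a \<Rightarrow> 'a) UNIV = 2"
    and BJ: "BJ_normed ((*\<^sub>R) :: real \<Rightarrow> 'a \<Rightarrow> 'a)"
  then interpret normed_plane_over "(*\<^sub>R) :: real \<Rightarrow> 'a \<Rightarrow> 'a"
    by (simp add: normed_plane_over_def normed_plane_over_axioms_def normed_space_over_scaleR)
  show "smooth_point (*\<^sub>R) x \<longleftrightarrow>
         \<not> has_loop (\<Gamma>\<^sub>0 (*\<^sub>R)) x \<and>
         (\<forall>u \<in> out_nbhd (\<Gamma>\<^sub>0 (*\<^sub>R)) x - {0}. \<forall>v \<in> out_nbhd (\<Gamma>\<^sub>0 (*\<^sub>R)) x - {0}.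
            BJ_equivalent (*\<^sub>R) u v)"
    by (intro smooth_point_iff_BJ_equivalent BJ ex_BJ_orthogonal_real)
next
  assume space: "normed_space_over scaleC" and "vector_space.dim scaleC UNIV = 2"
    and BJ: "BJ_normed scaleC"
  then interpret normed_plane_over scaleC
    by (simp add: normed_plane_over_def normed_plane_over_axioms_def)
  show "smooth_point scaleC z \<longleftrightarrow>
         \<not> has_loop (\<Gamma>\<^sub>0 scaleC) z \<and>
         (\<forall>u \<in> out_nbhd (\<Gamma>\<^sub>0 scaleC) z - {0}. \<forall>v \<in> out_nbhd (\<Gamma>\<^sub>0 scaleC) z - {0}.
            BJ_equivalent scaleC u v)"
    by (intro smooth_point_iff_BJ_equivalent BJ ex_BJ_orthogonal_complex space)
qed

end
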